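(* Let $1\le n_0<N$ be integers, let $x_1,\ldots,x_{n_0}\in\mathbb{R}$ be the observed values and let $\overline{x}\in\mathbb{R}$ be the prescribed final value at time $N$. Let $(a,b)$ be a least squares solution of the autoregressive equations $x_n=a x_{n-1}+b$ for the first $n_0$ observations, i.e. $(a,b)\in\mathbb{R}^2$ minimizes $\sum_{n=2}^{n_0}(x_n-ax_{n-1}-b)^2$. Let $\widehat x_{n_0}=x_{n_0}$ and $\widehat x_n=a\widehat x_{n-1}+b$ for $n=n_0+1,\ldots,N$. Then the best predictors $\widetilde x_{n_0+1},\ldots,\widetilde x_{N-1}$ of the missing values (in the sense of the control problem defined in the context) are given by $\widetilde x_{n_0}=\widehat x_{n_0}$ and $$\widetilde x_n=a\widetilde x_{n-1}+b+\frac{\overline{x}-\widehat x_N}{\sum_{i=n_0+1}^{N}a^{2(N-i)}}\cdot a^{N-n},\qquad n=n_0+1,\ldots,N-1.$$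
   Context: The time series is $x_1,\ldots,x_{n_0},\widetilde x_{n_0+1},\ldots,\widetilde x_{N-1},x_N=\overline{x}$, where $x_1,\ldots,x_{n_0}$ are observed, the final value $x_N=\overline{x}$ is known, and the values at times $n_0+1,\ldots,N-1$ are missing and are to be predicted; one also writes $\widetilde x_N=x_N=\overline{x}$. Control problem and best predictors: given real $a,b$ and a real control sequence $u_{n_0+1},\ldots,u_N$, define $\widetilde x_{n_0}=\widehat x_{n_0}=x_{n_0}$ and $\widetilde x_n=a\widetilde x_{n-1}+b+u_n$ for $n=n_0+1,\ldots,N$. The best predictors of the missing values are the values $\widetilde x_{n_0+1},\ldots,\widetilde x_{N-1}$ produced by a control sequence that minimizes $\sum_{n=n_0+1}^{N}u_n^2$ among all control sequences satisfying the terminal constraint $\widetilde x_N=\overline{x}$. The convention $0^0=1$ is used. *)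

theory Defs
  imports Complex_Main
begin

(* Series are functions on nat; only the indices 1..n0 of the observations x are used. *)

definition least_squares_AR1 :: "nat \<Rightarrow> (nat \<Rightarrow> real) \<Rightarrow> real \<Rightarrow> real \<Rightarrow> bool" where
  "least_squares_AR1 n0 x a b \<longleftrightarrow>
     is_arg_min (\<lambda>(\<alpha>, \<beta>). \<Sum>n = 2..n0. (x n - \<alpha> * x (n - 1) - \<beta>)\<^sup>2) (\<lambda>_. True) (a, b)"

(* The observed series up to time n0, continued by the controlled recursion. *)
fun controlled_series ::
  "real \<Rightarrow> real \<Rightarrow> nat \<Rightarrow> (nat \<Rightarrow> real) \<Rightarrow> (nat \<Rightarrow> real) \<Rightarrow> nat \<Rightarrow> real" where
  "controlled_series a b n0 x u n =
     (if n \<le> n0 then x n else a * controlled_series a b n0 x u (n - 1) + b + u n)"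

declare controlled_series.simps [simp del]

(* A control is a function on nat of which only the values u (n0+1), ..., u N matter:
   neither the constraint nor the cost depends on the others. *)
definition optimal_control ::
  "real \<Rightarrow> real \<Rightarrow> nat \<Rightarrow> nat \<Rightarrow> (nat \<Rightarrow> real) \<Rightarrow> real \<Rightarrow> (nat \<Rightarrow> real) \<Rightarrow> bool" where
  "optimal_control a b n0 N x xbar u \<longleftrightarrow>
     is_arg_min (\<lambda>v. \<Sum>n = n0 + 1..N. (v n)\<^sup>2) (\<lambda>v. controlled_series a b n0 x v N = xbar) u"

definition best_predictors ::
  "real \<Rightarrow> real \<Rightarrow> nat \<Rightarrow> nat \<Rightarrow> (nat \<Rightarrow> real) \<Rightarrow> real \<Rightarrow> (nat \<Rightarrow> real) \<Rightarrow> bool" where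
  "best_predictors a b n0 N x xbar y \<longleftrightarrow>
     (\<exists>u. optimal_control a b n0 N x xbar u \<and>
          (\<forall>n\<in>{n0 + 1..N - 1}. y n = controlled_series a b n0 x u n))"

end

theory Submission
  imports Defs
begin

text \<open>
  Unrolling the recursion shows that a control \<open>u\<close> moves the final value of the series away
  from the uncontrolled forecast by \<open>\<Sum>i = n0 + 1..N. a ^ (N - i) * u i\<close>
  (\<open>controlled_series_superposition\<close>).  The terminal condition is therefore a single linear
  equation \<open>\<langle>w, u\<rangle> = d\<close> with \<open>w i = a ^ (N - i)\<close>, where \<open>d\<close> is the amount by which the
  uncontrolled forecast misses the target.  A control of least energy is the point of this
  hyperplane that is nearest to the origin, so it is the multiple \<open>(d / \<langle>w, w\<rangle>) w\<close> of the
  normal vector, and by Pythagoras (\<open>sum_squares_on_hyperplane\<close>) every other point of the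
  hyperplane is strictly farther away.  Here \<open>\<langle>w, w\<rangle> > 0\<close> even for \<open>a = 0\<close>, because
  \<open>w N = a ^ 0 = 1\<close>.
\<close>

text \<open>
  Each control value enters the series once and is then multiplied by \<open>a\<close> at every later step.
\<close>

lemma controlled_series_superposition:
  assumes "z n0 = x n0"
    and "\<forall>k\<in>{n0 + 1..N}. z k = a * z (k - 1) + b"
    and "n0 \<le> n" and "n \<le> N"
  shows "controlled_series a b n0 x u n = z n + (\<Sum>i = n0 + 1..n. a ^ (n - i) * u i)"
  using assms(3,4)
proof (induction n rule: dec_induct)
  case base
  then show ?case
    using assms(1) by (simp add: controlled_series.simps[of a b n0 x u n0])
next
  case (step n)
  have "(\<Sum>i = n0 + 1..Suc n. a ^ (Suc n - i) * u i) =
        (\<Sum>i = n0 + 1..n. a ^ (Suc n - i) * u i) + u (Suc n)"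
    using step.hyps by simp
  also have "(\<Sum>i = n0 + 1..n. a ^ (Suc n - i) * u i) = a * (\<Sum>i = n0 + 1..n. a ^ (n - i) * u i)"
    by (simp add: sum_distrib_left Suc_diff_le mult.assoc)
  finally have sum: "(\<Sum>i = n0 + 1..Suc n. a ^ (Suc n - i) * u i) =
        a * (\<Sum>i = n0 + 1..n. a ^ (n - i) * u i) + u (Suc n)" .
  have "z (Suc n) = a * z n + b"
    using assms(2)[rule_format, of "Suc n"] step by simp
  then show ?case
    using step sum by (simp add: controlled_series.simps[of a b n0 x u "Suc n"] algebra_simps)
qed

lemma controlled_series_unique:
  assumes "y n0 = x n0"
    and "\<forall>k\<in>{n0 + 1..m}. y k = a * y (k - 1) + b + u k"
    and "n0 \<le> n" and "n \<le> m"
  shows "controlled_series a b n0 x u n = y n"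
  using assms(3,4)
proof (induction n rule: dec_induct)
  case base
  then show ?case
    using assms(1) by (simp add: controlled_series.simps[of a b n0 x u n0])
next
  case (step n)
  then show ?case
    using assms(2)[rule_format, of "Suc n"]
    by (simp add: controlled_series.simps[of a b n0 x u "Suc n"])
qed

text \<open>
  The difference of \<open>v\<close> and the foot \<open>(d / \<langle>w, w\<rangle>) w\<close> of the perpendicular from the origin lies
  in the hyperplane \<open>\<langle>w, \<cdot>\<rangle> = 0\<close>, so it is orthogonal to \<open>w\<close> and the squared lengths add up.
\<close>

lemma sum_squares_on_hyperplane:
  fixes v w :: "'i \<Rightarrow> real" and I :: "'i set"
  defines "S \<equiv> \<Sum>i\<in>I. (w i)\<^sup>2"
  assumes "S \<noteq> 0" and "(\<Sum>i\<in>I. w i * v i) = d"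
  shows "(\<Sum>i\<in>I. (v i)\<^sup>2) = (\<Sum>i\<in>I. (d / S * w i)\<^sup>2) + (\<Sum>i\<in>I. (v i - d / S * w i)\<^sup>2)"
proof -
  define c where "c = d / S"
  have "(\<Sum>i\<in>I. (v i)\<^sup>2) = (\<Sum>i\<in>I. (c * w i)\<^sup>2 + (v i - c * w i)\<^sup>2
          + (2 * c * (w i * v i) - 2 * c\<^sup>2 * (w i)\<^sup>2))"
    by (rule sum.cong) (simp_all add: power2_eq_square algebra_simps)
  also have "\<dots> = (\<Sum>i\<in>I. (c * w i)\<^sup>2) + (\<Sum>i\<in>I. (v i - c * w i)\<^sup>2) + (2 * c * d - 2 * c\<^sup>2 * S)"
    using assms(3) by (simp add: sum.distrib sum_subtractf S_def flip: sum_distrib_left)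
  also have "2 * c * d - 2 * c\<^sup>2 * S = 0"
    using assms(2) by (simp add: c_def power2_eq_square)
  finally show ?thesis
    by (simp add: c_def)
qed

theorem theorem3p1:
  fixes n0 N :: nat and x xhat xtilde :: "nat \<Rightarrow> real" and xbar a b :: real
  assumes "1 \<le> n0" and "n0 < N"
    and "least_squares_AR1 n0 x a b"
    and "xhat n0 = x n0"
    and "\<forall>n\<in>{n0 + 1..N}. xhat n = a * xhat (n - 1) + b"
    and "xtilde n0 = xhat n0"
    and "\<forall>n\<in>{n0 + 1..N - 1}. xtilde n = a * xtilde (n - 1) + b
           + (xbar - xhat N) / (\<Sum>i = n0 + 1..N. a ^ (2 * (N - i))) * a ^ (N - n)"
  shows "best_predictors a b n0 N x xbar xtilde \<and>
         (\<forall>y. best_predictors a b n0 N x xbar y \<longrightarrow> (\<forall>n\<in>{n0 + 1..N - 1}. y n = xtilde n))"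
proof -
  define d where "d = xbar - xhat N"
  define w where "w = (\<lambda>i. a ^ (N - i))"
  define S where "S = (\<Sum>i = n0 + 1..N. (w i)\<^sup>2)"
  define us where "us = (\<lambda>i. d / S * w i)"
  have S_eq: "(\<Sum>i = n0 + 1..N. a ^ (2 * (N - i))) = S"
    by (simp add: S_def w_def mult.commute flip: power_mult)
  have "(w N)\<^sup>2 \<le> S"
    unfolding S_def using assms(2) by (intro member_le_sum) auto
  then have S_pos: "S > 0"
    by (simp add: w_def)
  have feasible_iff: "controlled_series a b n0 x v N = xbar \<longleftrightarrow> (\<Sum>i = n0 + 1..N. w i * v i) = d" for v
    using controlled_series_superposition[of xhat n0 x N a b N v] assms(2,4,5)
    by (auto simp: w_def d_def)
  have us_feasible: "(\<Sum>i = n0 + 1..N. w i * us i) = d"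
  proof -
    have "(\<Sum>i = n0 + 1..N. w i * us i) = d / S * S"
      unfolding us_def S_def sum_distrib_left
      by (rule sum.cong) (simp_all add: power2_eq_square)
    then show ?thesis
      using S_pos by simp
  qed
  have cost: "(\<Sum>i = n0 + 1..N. (v i)\<^sup>2) =
      (\<Sum>i = n0 + 1..N. (us i)\<^sup>2) + (\<Sum>i = n0 + 1..N. (v i - us i)\<^sup>2)"
    if "(\<Sum>i = n0 + 1..N. w i * v i) = d" for v
    using sum_squares_on_hyperplane[of w "{n0 + 1..N}" v d] that S_pos
    by (simp add: us_def S_def)
  have us_optimal: "optimal_control a b n0 N x xbar us"
    unfolding optimal_control_def is_arg_min_linorder feasible_iff
  proof (intro conjI allI impI)
    fix v assume "(\<Sum>i = n0 + 1..N. w i * v i) = d"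
    from cost[OF this] show "(\<Sum>i = n0 + 1..N. (us i)\<^sup>2) \<le> (\<Sum>i = n0 + 1..N. (v i)\<^sup>2)"
      by (simp add: sum_nonneg)
  qed (rule us_feasible)
  have optimal_unique: "\<forall>n\<in>{n0 + 1..N}. u n = us n" if "optimal_control a b n0 N x xbar u" for u
  proof -
    have feas: "(\<Sum>i = n0 + 1..N. w i * u i) = d"
      and "(\<Sum>i = n0 + 1..N. (u i)\<^sup>2) \<le> (\<Sum>i = n0 + 1..N. (us i)\<^sup>2)"
      using that us_feasible
      unfolding optimal_control_def is_arg_min_linorder feasible_iff by blast+
    then have "(\<Sum>i = n0 + 1..N. (u i - us i)\<^sup>2) \<le> 0"
      using cost[OF feas] by linarith
    then have "(\<Sum>i = n0 + 1..N. (u i - us i)\<^sup>2) = 0"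
      by (simp add: order_antisym sum_nonneg)
    then show ?thesis
      by (subst (asm) sum_nonneg_eq_0_iff) auto
  qed
  have xtilde: "controlled_series a b n0 x u n = xtilde n"
    if "\<forall>n\<in>{n0 + 1..N}. u n = us n" "n \<in> {n0 + 1..N - 1}" for u n
  proof (rule controlled_series_unique)
    show "xtilde n0 = x n0"
      using assms(4,6) by simp
    show "\<forall>k\<in>{n0 + 1..N - 1}. xtilde k = a * xtilde (k - 1) + b + u k"
      using assms(7) that(1) unfolding S_eq by (auto simp: us_def w_def d_def)
  qed (use that(2) in auto)
  show ?thesis
    using us_optimal optimal_unique xtilde unfolding best_predictors_def by metis
qed

end
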